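(* For every $n\ge1$, the path on $n$ vertices is $123$-representable by a $2$-uniform word, i.e., for some labeling of its vertices by distinct elements of a totally ordered set it is represented by a $123$-avoiding word in which every letter occurs exactly twice.
   Context: A word is a finite sequence of letters from a totally ordered alphabet. Two letters $x,y$ alternate in a word $w$ if between any two occurrences of $x$ there is an occurrence of $y$ and between any two occurrences of $y$ there is an occurrence of $x$. A graph $G=(V,E)$ is represented by a word $w$ over $V$ if for all distinct $x,y\in V$, $x$ and $y$ alternate in $w$ if and only if $xy\in E$. A word is $123$-avoiding if it has no strictly increasing subsequence of length $3$. *)

theory Defs
  imports Main "HOL-Library.Sublist"
begin

definition alternate :: "'a \<Rightarrow> 'a \<Rightarrow> 'a list \<Rightarrow> bool" where
  "alternate x y w \<longleftrightarrow>
     (\<forall>i j. i < j \<and> j < length w \<and> w ! i = x \<and> w ! j = x \<longrightarrow> (\<exists>k. i < k \<and> k < j \<and> w ! k = y)) \<and>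
     (\<forall>i j. i < j \<and> j < length w \<and> w ! i = y \<and> w ! j = y \<longrightarrow> (\<exists>k. i < k \<and> k < j \<and> w ! k = x))"

text \<open>A simple graph is a pair of a vertex set and a set of two-element sets of vertices.\<close>

type_synonym 'a ugraph = "'a set \<times> 'a set set"

definition represents :: "'a list \<Rightarrow> 'a ugraph \<Rightarrow> bool" where
  "represents w G \<longleftrightarrow> set w \<subseteq> fst G \<and>
     (\<forall>x\<in>fst G. \<forall>y\<in>fst G. x \<noteq> y \<longrightarrow> (alternate x y w \<longleftrightarrow> {x, y} \<in> snd G))"

definition avoids_123 :: "'a::linorder list \<Rightarrow> bool" where
  "avoids_123 w \<longleftrightarrow> \<not> (\<exists>u. subseq u w \<and> length u = 3 \<and> sorted_wrt (<) u)"

text \<open>The letters counted are all vertices, so a uniform word has to contain every vertex.\<close>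

definition uniform_over :: "nat \<Rightarrow> 'a set \<Rightarrow> 'a list \<Rightarrow> bool" where
  "uniform_over k V w \<longleftrightarrow> (\<forall>x\<in>V. count_list w x = k)"

definition relabel :: "('a \<Rightarrow> 'b) \<Rightarrow> 'a ugraph \<Rightarrow> 'b ugraph" where
  "relabel f G = (f ` fst G, (\<lambda>e. f ` e) ` snd G)"

text \<open>HOL cannot quantify existentially over types, so the totally ordered set of labels is
  taken to be \<open>nat\<close>; every finite totally ordered set embeds into it preserving the order.\<close>

definition uniformly_123_representable :: "nat \<Rightarrow> 'a ugraph \<Rightarrow> bool" where
  "uniformly_123_representable k G \<longleftrightarrow>
     (\<exists>(f :: 'a \<Rightarrow> nat) w. inj_on f (fst G) \<and> represents w (relabel f G) \<and>
        avoids_123 w \<and> uniform_over k (fst (relabel f G)) w)"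

definition path_graph :: "nat \<Rightarrow> nat ugraph" where
  "path_graph n = ({0..<n}, {{i, Suc i} | i. Suc i < n})"

end

theory Submission
  imports Defs
begin

text \<open>Number the path \<open>v\<^sub>0, v\<^sub>1, \<dots>\<close> and consider the word
  \<open>v\<^sub>0 v\<^sub>1 v\<^sub>0 v\<^sub>2 v\<^sub>1 v\<^sub>3 v\<^sub>2 \<dots>\<close>, in which only neighbours alternate. If the labels decrease
  along the path, a letter exceeds an earlier one by at most 1, because both copies of \<open>v\<^sub>i\<close>
  precede both copies of \<open>v\<^sub>j\<close> whenever \<open>j \<ge> i + 2\<close>; hence no increasing subsequence has
  length 3.\<close>

definition occurs_at :: "'a \<Rightarrow> nat \<Rightarrow> nat \<Rightarrow> 'a list \<Rightarrow> bool" where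
  "occurs_at x a b w \<longleftrightarrow>
     a < b \<and> b < length w \<and> (\<forall>k<length w. w ! k = x \<longleftrightarrow> k = a \<or> k = b)"

lemma occurs_atD:
  assumes "occurs_at x a b w"
  shows "a < b" "b < length w" "w ! a = x" "w ! b = x"
    and "k < length w \<Longrightarrow> w ! k = x \<longleftrightarrow> k = a \<or> k = b"
  using assms by (auto simp: occurs_at_def)

lemma count_list_occurs_at:
  assumes "occurs_at x a b w"
  shows "count_list w x = 2"
proof -
  have "{k. k < length w \<and> x = w ! k} = {a, b}"
    using occurs_atD[OF assms] by (auto simp: eq_commute)
  then show ?thesis
    using occurs_atD[OF assms] by (simp add: count_list_eq_length_filter length_filter_conv_card)
qed

text \<open>Each letter bounds one interval, and each interval must contain an endpoint of the
  other; nested or disjoint intervals fail this, so only crossing ones remain.\<close>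

lemma alternate_occurs_at:
  assumes x: "occurs_at x a b w" and y: "occurs_at y c d w" and "x \<noteq> y"
  shows "alternate x y w \<longleftrightarrow> a < c \<and> c < b \<and> b < d \<or> c < a \<and> a < d \<and> d < b"
proof -
  \<comment> \<open>One half of alternation, for arbitrary letters so that it applies in both
    orders.\<close>
  have gap: "(\<forall>i j. i < j \<and> j < length w \<and> w ! i = x \<and> w ! j = x \<longrightarrow>
                 (\<exists>k. i < k \<and> k < j \<and> w ! k = y)) \<longleftrightarrow> (a < c \<and> c < b \<or> a < d \<and> d < b)"
    (is "?L \<longleftrightarrow> ?R")
    if x: "occurs_at x a b w" and y: "occurs_at y c d w" for x y a b c d
  proof
    assume ?L
    then obtain k where "a < k" "k < b" "w ! k = y"
      using occurs_atD(1-4)[OF x] by blast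
    then show ?R using occurs_atD(2)[OF x] occurs_atD(5)[OF y, of k] by auto
  next
    assume R: ?R
    have "i = a \<and> j = b" if "i < j" "j < length w" "w ! i = x" "w ! j = x" for i j
      using occurs_atD(1)[OF x] occurs_atD(5)[OF x, of i] occurs_atD(5)[OF x, of j] that by auto
    then show ?L using R occurs_atD(3,4)[OF y] by blast
  qed
  have "a \<noteq> c" "a \<noteq> d" "b \<noteq> c" "b \<noteq> d" "a < b" "c < d"
    using occurs_atD(1,3,4)[OF x] occurs_atD(1,3,4)[OF y] \<open>x \<noteq> y\<close> by auto
  then show ?thesis
    unfolding alternate_def gap[OF x y] gap[OF y x] by auto
qed

text \<open>In an increasing triple the last entry exceeds the first by at least 2.\<close>

lemma avoids_123_if_nth_le_Suc:
  fixes w :: "nat list"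
  assumes "\<And>i j. i < j \<Longrightarrow> j < length w \<Longrightarrow> w ! j \<le> Suc (w ! i)"
  shows "avoids_123 w"
  unfolding avoids_123_def
proof
  assume "\<exists>u. subseq u w \<and> length u = 3 \<and> sorted_wrt (<) u"
  then obtain x y z where s: "subseq [x, y, z] w" and lt: "x < y" "y < z"
    by (auto simp: numeral_3_eq_3 length_Suc_conv)
  obtain us vs where w: "w = us @ x # vs" and "subseq [y, z] vs"
    using list_emb_ConsD[OF s] by auto
  then have "z \<in> set vs" by (auto dest: list_emb_set)
  then obtain k where "k < length vs" "vs ! k = z" by (auto simp: in_set_conv_nth)
  then have "z \<le> Suc x"
    using assms[of "length us" "length us + Suc k"] w by (auto simp: nth_append)
  with lt show False by simp
qed

text \<open>Truncated subtraction supplies both ends of the word: position 0 gets the label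
  \<open>n - 1\<close> of \<open>v\<^sub>0\<close>, and position \<open>2 * n - 1\<close> the label 0 of the last vertex.\<close>

definition path_word :: "nat \<Rightarrow> nat list" where
  "path_word n =
     map (\<lambda>k. n - 1 - (if even k then k div 2 - 1 else Suc k div 2)) [0..<2 * n]"

text \<open>The label \<open>x\<close> belongs to \<open>v\<^sub>i\<close> with
  \<open>i = n - 1 - x\<close>, whose copies are at 2i - 1 and 2i + 2 away from the ends; for i = 0
  truncation gives position 0.\<close>

definition first_pos :: "nat \<Rightarrow> nat \<Rightarrow> nat" where
  "first_pos n x = 2 * (n - 1 - x) - 1"

text \<open>For \<open>x = 0\<close> the general formula would point one past the end of the
  word.\<close>

definition last_pos :: "nat \<Rightarrow> nat \<Rightarrow> nat" where
  "last_pos n x = (if x = 0 then 2 * n - 1 else 2 * (n - x))"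

lemma length_path_word [simp]: "length (path_word n) = 2 * n"
  by (simp add: path_word_def)

lemma nth_path_word:
  "k < 2 * n \<Longrightarrow>
     path_word n ! k = n - 1 - (if even k then k div 2 - 1 else Suc k div 2)"
  by (simp add: path_word_def)

lemma occurs_at_path_word:
  assumes "x < n"
  shows "occurs_at x (first_pos n x) (last_pos n x) (path_word n)"
  unfolding occurs_at_def
proof (intro conjI allI impI)
  show "first_pos n x < last_pos n x" "last_pos n x < length (path_word n)"
    using assms by (auto simp: first_pos_def last_pos_def)
next
  fix k
  assume k: "k < length (path_word n)"
  \<comment> \<open>Here \<open>p\<close> is the index on the path of the vertex labelled
    \<open>x\<close>; \<open>p = 0\<close> and, for even \<open>k\<close>, \<open>l = 0\<close> are
    the cases where subtraction truncates.\<close>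
  obtain p where n: "n = x + Suc p"
    using less_imp_Suc_add[OF assms] by auto
  show "path_word n ! k = x \<longleftrightarrow> k = first_pos n x \<or> k = last_pos n x"
  proof (cases "even k")
    case True
    then obtain l where "k = 2 * l" by (elim evenE)
    with k n show ?thesis
      by (cases l; cases p; auto simp: nth_path_word first_pos_def last_pos_def; presburger)
  next
    case False
    then obtain l where "k = 2 * l + 1" by (elim oddE)
    with k n show ?thesis
      by (cases l; cases p; auto simp: nth_path_word first_pos_def last_pos_def; presburger)
  qed
qed

text \<open>Away from the ends, the interval from 2i - 1 to 2i + 2 crosses the one starting at 2i +
  1 and ends before the one starting at 2i + 3.\<close>

lemma alternate_path_word:
  assumes "x < n" "y < n" "x \<noteq> y"
  shows "alternate x y (path_word n) \<longleftrightarrow> y = Suc x \<or> x = Suc y"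
proof -
  have greater: "alternate x y (path_word n) \<longleftrightarrow> x = Suc y" if "x < n" "y < x" for x y
  proof -
    obtain p e where "x = y + Suc e" "n = y + Suc e + Suc p"
      using less_imp_Suc_add[OF \<open>x < n\<close>] less_imp_Suc_add[OF \<open>y < x\<close>] by auto
    with that show ?thesis
      by (subst alternate_occurs_at[OF occurs_at_path_word occurs_at_path_word])
        (auto simp: first_pos_def last_pos_def)
  qed
  have "alternate x y (path_word n) \<longleftrightarrow> alternate y x (path_word n)"
    by (auto simp: alternate_def)
  then show ?thesis
    using greater[of x y] greater[of y x] assms by (cases "x < y") auto
qed

lemma avoids_123_path_word: "avoids_123 (path_word n)"
proof (rule avoids_123_if_nth_le_Suc)
  fix i j
  assume ij: "i < j" "j < length (path_word n)"
  \<comment> \<open>Within one parity class labels never increase. A rise needs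
    \<open>i = 2 * a + 1\<close> and \<open>j = 2 * b\<close> with \<open>b > a\<close>, where the
    path indices are a + 1 and b - 1 \<ge> a.\<close>
  obtain a where "i = 2 * a \<or> i = 2 * a + 1" by (metis evenE oddE)
  moreover obtain b where "j = 2 * b \<or> j = 2 * b + 1" by (metis evenE oddE)
  ultimately show "path_word n ! j \<le> Suc (path_word n ! i)"
    using ij by (auto simp: nth_path_word)
qed

lemma fst_relabel_path_graph:
  "fst (relabel (\<lambda>i. n - 1 - i) (path_graph n)) = {0..<n}"
proof -
  have "x \<in> (\<lambda>i. n - 1 - i) ` {0..<n}" if "x < n" for x
    \<comment> \<open>The reversal is its own inverse on \<open>{0..<n}\<close>.\<close>
    using that by (intro image_eqI[of _ _ "n - 1 - x"]) auto
  then show ?thesis by (auto simp: relabel_def path_graph_def)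
qed

lemma edge_relabel_path_graph:
  assumes "x < n" "y < n"
  shows "{x, y} \<in> snd (relabel (\<lambda>i. n - 1 - i) (path_graph n)) \<longleftrightarrow> y = Suc x \<or> x = Suc y"
    (is "?E x y \<longleftrightarrow> _")
proof
  assume "?E x y"
  then obtain i where "Suc i < n" "{x, y} = {n - 1 - i, n - 1 - Suc i}"
    by (auto simp: relabel_def path_graph_def)
  then show "y = Suc x \<or> x = Suc y" by (auto simp: doubleton_eq_iff)
next
  have edge: "?E z (Suc z)" if "Suc z < n" for z
  proof -
    \<comment> \<open>Reversal swaps the ends of an edge, so the preimage of
      \<open>{z, Suc z}\<close> starts at the preimage of \<open>Suc z\<close>.\<close>
    define i where "i = n - 1 - Suc z"
    have "Suc i < n" "n - 1 - i = Suc z" "n - 1 - Suc i = z"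
      using that by (auto simp: i_def)
    then have "(\<lambda>i. n - 1 - i) ` {i, Suc i} = {z, Suc z}" by auto
    with \<open>Suc i < n\<close> show ?thesis
      unfolding relabel_def path_graph_def by (auto intro!: image_eqI[of _ _ "{i, Suc i}"])
  qed
  assume "y = Suc x \<or> x = Suc y"
  then show "?E x y" using edge[of x] edge[of y] assms by (auto simp: insert_commute)
qed

theorem theorem4p2:
  fixes n :: nat
  assumes "n \<ge> 1"
  shows "uniformly_123_representable 2 (path_graph n)"
  unfolding uniformly_123_representable_def
proof (intro exI conjI)
  show "inj_on (\<lambda>i. n - 1 - i) (fst (path_graph n))"
    by (auto simp: inj_on_def path_graph_def)
  have "set (path_word n) \<subseteq> {0..<n}"
    using assms by (auto simp: path_word_def)
  then show "represents (path_word n) (relabel (\<lambda>i. n - 1 - i) (path_graph n))"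
    unfolding represents_def fst_relabel_path_graph
    by (simp add: alternate_path_word edge_relabel_path_graph del: One_nat_def)
  show "avoids_123 (path_word n)" by (rule avoids_123_path_word)
  show "uniform_over 2 (fst (relabel (\<lambda>i. n - 1 - i) (path_graph n))) (path_word n)"
    unfolding uniform_over_def fst_relabel_path_graph
    by (simp add: count_list_occurs_at[OF occurs_at_path_word])
qed

end
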